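(* Let $n \ge 2$, $i, j \in \{1,\dots,n\}$ and let $g \colon I^n \to \mathbb{R}$ be a continuous function. (i) If $\mathsf{Conn}_i(g) = \emptyset$, then $\bigcap_{k \ne i} \mathsf{Conn}_k(g)$ is a compact interval. (ii) $\mathsf{Sep}(g) \ne \emptyset$ if and only if $|\mathsf{Conn}_k(g)| \le 1$ for some $k \in \{1,\dots,n\}$. (iii) If the sets $\mathsf{Conn}_i(g)$ and $\mathsf{Conn}_j(g)$ are nonempty, then $\mathsf{Conn}_i(g) \cap \mathsf{Conn}_j(g) \ne \emptyset$. (iv) If $\mathsf{Conn}_k(g) \ne \emptyset$ for each $k \in \{1,\dots,n\}$, then $\bigcap_{k=1}^n \mathsf{Conn}_k(g) \ne \emptyset$. (v) If $\mathsf{Conn}_k(g) \ne \emptyset$ for each $k \ne i$, then the set $g^{-1}\left[\bigcap_{k \ne i} \mathsf{Conn}_k(g)\right]$ connects $i$th opposite faces of $I^n$. (vi) The sets $\mathsf{Conn}(g)$ and $\mathsf{Sep}(g)$ are compact and connected.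
   Context: $I^n = [0,1]^n$; for $i \in \{1,\dots,n\}$, $I^n_{i,-} = \{z \in I^n : z_i = 0\}$ and $I^n_{i,+} = \{z \in I^n : z_i = 1\}$. A subset $A \subset I^n$ connects $i$th opposite faces of $I^n$ if there is a connected subset $S \subset A$ with $S \cap I^n_{i,-} \ne \emptyset \ne S \cap I^n_{i,+}$; $A$ separates $i$th opposite faces of $I^n$ if $I^n \setminus A$ does not connect $i$th opposite faces of $I^n$. For a continuous $g \colon I^n \to \mathbb{R}$, $\mathsf{Conn}_i(g)$ (resp. $\mathsf{Sep}_i(g)$) is the set of all $p \in \mathbb{R}$ such that $g^{-1}[\{p\}]$ connects (resp. separates) $i$th opposite faces of $I^n$; $\mathsf{Conn}(g) = \bigcup_{i=1}^n \mathsf{Conn}_i(g)$ and $\mathsf{Sep}(g) = \bigcup_{i=1}^n \mathsf{Sep}_i(g)$. Intersections $\bigcap_{k\neq i}$ range over $k \in \{1,\dots,n\}\setminus\{i\}$. "Compact interval" means a nondegenerate compact interval $[a,b]$ with $a<b$. The empty set is regarded as compact and connected. *)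

theory Defs
  imports "HOL-Analysis.Analysis"
begin

text \<open>The cube of dimension n is taken in \<open>real ^ 'n\<close>, with n = \<open>CARD('n)\<close>;
  the coordinates 1, ..., n are the elements of the index type \<open>'n\<close>.\<close>

definition unit_cube :: "(real ^ 'n) set" where
  "unit_cube = {z. \<forall>i. 0 \<le> z $ i \<and> z $ i \<le> 1}"

definition face_minus :: "'n \<Rightarrow> (real ^ 'n) set" where
  "face_minus i = {z \<in> unit_cube. z $ i = 0}"

definition face_plus :: "'n \<Rightarrow> (real ^ 'n) set" where
  "face_plus i = {z \<in> unit_cube. z $ i = 1}"

text \<open>The next two notions are meant for subsets \<open>A\<close> of the cube.\<close>

definition connects_faces :: "'n::finite \<Rightarrow> (real ^ 'n) set \<Rightarrow> bool" where
  "connects_faces i A \<longleftrightarrow>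
     (\<exists>S. S \<subseteq> A \<and> connected S \<and> S \<inter> face_minus i \<noteq> {} \<and> S \<inter> face_plus i \<noteq> {})"

definition separates_faces :: "'n::finite \<Rightarrow> (real ^ 'n) set \<Rightarrow> bool" where
  "separates_faces i A \<longleftrightarrow> \<not> connects_faces i (unit_cube - A)"

text \<open>A function on the cube is a total function on \<open>real ^ 'n\<close> of which only the
  restriction to the cube is used; in particular preimages are taken inside the cube.\<close>

definition cube_preimage :: "(real ^ 'n \<Rightarrow> real) \<Rightarrow> real set \<Rightarrow> (real ^ 'n) set" where
  "cube_preimage g P = {z \<in> unit_cube. g z \<in> P}"

definition Conn_at :: "'n::finite \<Rightarrow> (real ^ 'n \<Rightarrow> real) \<Rightarrow> real set" where
  "Conn_at i g = {p. connects_faces i (cube_preimage g {p})}"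

definition Sep_at :: "'n::finite \<Rightarrow> (real ^ 'n \<Rightarrow> real) \<Rightarrow> real set" where
  "Sep_at i g = {p. separates_faces i (cube_preimage g {p})}"

definition Conn :: "(real ^ 'n::finite \<Rightarrow> real) \<Rightarrow> real set" where
  "Conn g = (\<Union>i. Conn_at i g)"

definition Sep :: "(real ^ 'n::finite \<Rightarrow> real) \<Rightarrow> real set" where
  "Sep g = (\<Union>i. Sep_at i g)"

definition compact_interval :: "real set \<Rightarrow> bool" where
  "compact_interval J \<longleftrightarrow> (\<exists>a b. a < b \<and> J = {a..b})"

end

theory Submission
  imports Defs
begin

text \<open>Put \<open>a\<^sub>k = min {p. {g \<le> p} connects the k-faces}\<close> and
  \<open>b\<^sub>k = max {p. {g \<ge> p} connects the k-faces}\<close>. If a closed subset of the cube does not connect the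
  \<open>k\<close>-faces, then some continuum disjoint from it meets every connected set joining the \<open>k\<close>-faces
  (the cube inherits this form of unicoherence from Euclidean space). Such a continuum lies on one
  side of a level set disjoint from it, so \<open>Conn\<^sub>k = [a\<^sub>k, b\<^sub>k]\<close> and \<open>Sep\<^sub>k = [b\<^sub>k, a\<^sub>k]\<close>; and it meets all
  \<open>j\<close>-faces with \<open>j \<noteq> k\<close>, which gives \<open>a\<^sub>k \<le> b\<^sub>j\<close>. Everything else is arithmetic with intervals.\<close>

subsection \<open>The cube and its faces\<close>

lemma unit_cube_eq_cbox: "unit_cube = cbox 0 (\<chi> i. 1)"
  by (auto simp: unit_cube_def mem_box_cart)

lemma compact_unit_cube: "compact (unit_cube :: (real ^ 'n::finite) set)"
  by (simp add: unit_cube_eq_cbox)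

lemma convex_unit_cube: "convex (unit_cube :: (real ^ 'n::finite) set)"
  by (simp add: unit_cube_eq_cbox)

lemma face_minus_eq: "face_minus i = unit_cube \<inter> {z. z $ i = 0}"
  by (auto simp: face_minus_def)

lemma face_plus_eq: "face_plus i = unit_cube \<inter> {z. z $ i = 1}"
  by (auto simp: face_plus_def)

lemma convex_component_eq: "convex {z :: real ^ 'n::finite. z $ i = c}"
  by (auto simp: convex_def simp flip: distrib_right)

lemma closed_component_eq: "closed {z :: real ^ 'n::finite. z $ i = c}"
  by (intro closed_Collect_eq continuous_intros)

lemma compact_face_minus: "compact (face_minus (i :: 'n::finite))"
  unfolding face_minus_eq by (intro compact_Int_closed compact_unit_cube closed_component_eq)

lemma compact_face_plus: "compact (face_plus (i :: 'n::finite))"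
  unfolding face_plus_eq by (intro compact_Int_closed compact_unit_cube closed_component_eq)

lemma connected_face_minus: "connected (face_minus (i :: 'n::finite))"
  unfolding face_minus_eq
  by (intro convex_connected convex_Int convex_unit_cube convex_component_eq)

lemma connected_face_plus: "connected (face_plus (i :: 'n::finite))"
  unfolding face_plus_eq
  by (intro convex_connected convex_Int convex_unit_cube convex_component_eq)

lemma face_minus_subset: "face_minus i \<subseteq> unit_cube"
  by (auto simp: face_minus_def)

lemma face_plus_subset: "face_plus i \<subseteq> unit_cube"
  by (auto simp: face_plus_def)

lemma face_minus_Int_face_plus: "face_minus i \<inter> face_plus i = {}"
  by (auto simp: face_minus_def face_plus_def)

lemma face_intersections_nonempty:
  fixes j k :: "'n::finite"
  assumes "j \<noteq> k"
  shows "face_minus j \<inter> face_minus k \<noteq> {}" "face_minus j \<inter> face_plus k \<noteq> {}"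
    and "face_plus j \<inter> face_minus k \<noteq> {}" "face_plus j \<inter> face_plus k \<noteq> {}"
proof -
  have "(0 :: real ^ 'n) \<in> face_minus j \<inter> face_minus k"
    "(\<chi> i. if i = k then 1 else (0 :: real)) \<in> face_minus j \<inter> face_plus k"
    "(\<chi> i. if i = j then 1 else (0 :: real)) \<in> face_plus j \<inter> face_minus k"
    "(\<chi> i. (1 :: real)) \<in> face_plus j \<inter> face_plus k"
    using assms by (auto simp: face_minus_def face_plus_def unit_cube_def)
  then show "face_minus j \<inter> face_minus k \<noteq> {}" "face_minus j \<inter> face_plus k \<noteq> {}"
    and "face_plus j \<inter> face_minus k \<noteq> {}" "face_plus j \<inter> face_plus k \<noteq> {}"
    by blast+
qed

lemma face_nonempty: "face_minus (k :: 'n::finite) \<noteq> {}" "face_plus (k :: 'n::finite) \<noteq> {}"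
proof -
  have "(0 :: real ^ 'n) \<in> face_minus k" "(\<chi> i. (1 :: real)) \<in> face_plus k"
    by (auto simp: face_minus_def face_plus_def unit_cube_def)
  then show "face_minus k \<noteq> {}" "face_plus k \<noteq> {}"
    by blast+
qed

lemma unit_cube_nonempty: "unit_cube \<noteq> ({} :: (real ^ 'n::finite) set)"
  using face_nonempty(1) face_minus_subset by blast

text \<open>The nearest-point projection. Composing with it carries facts about closed separators
  and open sets of Euclidean space over to the cube.\<close>

lemma unit_cube_retraction:
  obtains r :: "real ^ 'n::finite \<Rightarrow> real ^ 'n" where "\<And>S. continuous_on S r"
    "\<And>x. r x \<in> unit_cube" "\<And>x. x \<in> unit_cube \<Longrightarrow> r x = x"
proof
  note cl = compact_imp_closed[OF compact_unit_cube]
  show "continuous_on S (closest_point unit_cube)" for S :: "(real ^ 'n) set"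
    by (rule continuous_on_closest_point[OF convex_unit_cube cl unit_cube_nonempty])
  show "closest_point unit_cube x \<in> unit_cube" for x :: "real ^ 'n"
    by (rule closest_point_in_set[OF cl unit_cube_nonempty])
qed (rule closest_point_self)

lemma connects_faces_mono: "connects_faces i A \<Longrightarrow> A \<subseteq> B \<Longrightarrow> connects_faces i B"
  unfolding connects_faces_def by blast

lemma connects_faces_nonempty: "connects_faces i A \<Longrightarrow> A \<noteq> {}"
  unfolding connects_faces_def by blast

lemma connects_faces_unit_cube: "connects_faces (i :: 'n::finite) unit_cube"
  unfolding connects_faces_def
  using face_nonempty[of i] face_minus_subset[of i] face_plus_subset[of i]
    convex_connected[OF convex_unit_cube]
  by blast

subsection \<open>Separating continua\<close>

text \<open>The cut-wire-fence theorem in the compact space \<open>K\<close>: closed sets that no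
  connected set joins fall on opposite sides of a clopen partition. The faces, which need not lie in
  \<open>K\<close>, are then adjoined to the two halves.\<close>

lemma separation_of_compact_not_connecting:
  fixes K :: "(real ^ 'n::finite) set"
  assumes "compact K" "K \<subseteq> unit_cube" "\<not> connects_faces k K"
  obtains U V where "closed U" "closed V" "U \<inter> V = {}" "K \<subseteq> U \<union> V"
    "face_minus k \<subseteq> U" "face_plus k \<subseteq> V"
proof -
  let ?X = "top_of_set K"
  have "separated_between ?X (K \<inter> face_minus k) (K \<inter> face_plus k)"
  proof (rule cut_wire_fence_theorem)
    show "compact_space ?X"
      using assms(1) by (simp add: compact_space_subtopology)
    show "Hausdorff_space ?X"
      by (simp add: Hausdorff_space_subtopology)
    show "closedin ?X (K \<inter> face_minus k)" "closedin ?X (K \<inter> face_plus k)"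
      by (simp_all add: closedin_closed_Int compact_face_minus compact_face_plus compact_imp_closed)
    show "disjnt C (K \<inter> face_minus k) \<or> disjnt C (K \<inter> face_plus k)" if "connectedin ?X C" for C
      using that assms(3) unfolding connects_faces_def connectedin_subtopology disjnt_def by auto
  qed
  then obtain P Q where PQ: "closedin ?X P" "closedin ?X Q" "P \<union> Q = K" "P \<inter> Q = {}"
    "K \<inter> face_minus k \<subseteq> P" "K \<inter> face_plus k \<subseteq> Q"
    by (auto simp: separated_between_alt disjnt_def)
  show thesis
  proof
    have "closed P" "closed Q"
      using PQ(1,2) compact_imp_closed[OF assms(1)] by (auto intro: closedin_closed_trans)
    then show "closed (P \<union> face_minus k)" "closed (Q \<union> face_plus k)"
      by (auto simp: compact_face_minus compact_face_plus compact_imp_closed)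
    show "(P \<union> face_minus k) \<inter> (Q \<union> face_plus k) = {}"
      using PQ face_minus_Int_face_plus[of k] by blast
  qed (use PQ in auto)
qed

text \<open>A level set of a Urysohn function for the two halves, extended to all of Euclidean
  space, separates a point of one face from a point of the other, and there a single component of it
  already does so. Projecting that component back to the cube and closing it gives
  \<open>C\<close>.\<close>

lemma separating_continuum:
  fixes K :: "(real ^ 'n::finite) set"
  assumes "compact K" "K \<subseteq> unit_cube" "\<not> connects_faces k K"
  obtains C where "compact C" "connected C" "C \<subseteq> unit_cube" "C \<inter> K = {}"
    "\<And>T. \<lbrakk>connected T; T \<subseteq> unit_cube; T \<inter> face_minus k \<noteq> {}; T \<inter> face_plus k \<noteq> {}\<rbrakk> \<Longrightarrow> T \<inter> C \<noteq> {}"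
proof -
  obtain r :: "real ^ 'n \<Rightarrow> real ^ 'n" where
    r: "\<And>S. continuous_on S r" "\<And>x. r x \<in> unit_cube" "\<And>x. x \<in> unit_cube \<Longrightarrow> r x = x"
    using unit_cube_retraction by blast
  obtain U V where UV: "closed U" "closed V" "U \<inter> V = {}" "K \<subseteq> U \<union> V"
    "face_minus k \<subseteq> U" "face_plus k \<subseteq> V"
    using separation_of_compact_not_connecting assms by metis
  obtain f :: "real ^ 'n \<Rightarrow> real" where f: "continuous_on UNIV f"
      "\<And>x. x \<in> U \<Longrightarrow> f x = 0" "\<And>x. x \<in> V \<Longrightarrow> f x = 1"
    using UV Urysohn[of U V 0 1] by metis
  \<comment> \<open>On the cube \<open>h\<close> equals \<open>f\<close>, and \<open>r\<close> sends
    each level set of \<open>h\<close> to points of the cube where \<open>f\<close> has the same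
    value.\<close>
  define h where "h = f \<circ> r"
  have h: "continuous_on UNIV h"
    unfolding h_def by (intro continuous_on_compose r continuous_on_subset[OF f(1)]) simp
  have hU: "h x = 0" if "x \<in> U \<inter> unit_cube" for x
    using that r f by (simp add: h_def)
  have hV: "h x = 1" if "x \<in> V \<inter> unit_cube" for x
    using that r f by (simp add: h_def)
  define S where "S = {x. h x = 1/2}"
  have "closed S"
    unfolding S_def by (intro closed_Collect_eq h continuous_intros)
  obtain a b where ab: "a \<in> face_minus k" "b \<in> face_plus k"
    using face_nonempty by blast
  have h_ab: "h a = 0" "h b = 1"
    using ab UV hU hV face_minus_subset face_plus_subset by blast+
  have "\<not> connected_component (- S) a b"
  proof
    assume "connected_component (- S) a b"
    then obtain T where T: "connected T" "T \<subseteq> - S" "a \<in> T" "b \<in> T"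
      by (auto simp: connected_component_def)
    have "connected (h ` T)"
      by (intro connected_continuous_image T continuous_on_subset[OF h]) simp
    then have "1/2 \<in> h ` T"
      using T h_ab connectedD_interval[of "h ` T" 0 1 "1/2"] by force
    then show False
      using T by (auto simp: S_def)
  qed
  \<comment> \<open>Unicoherence of Euclidean space enters here: if a closed set separates two
    points, so does one of its components.\<close>
  then obtain D where D: "D \<in> components S" "\<not> connected_component (- D) a b"
    using separation_by_component_closed_pointwise \<open>closed S\<close> by metis
  have D_h: "h x = 1/2" if "x \<in> D" for x
    using D(1) in_components_subset that by (fastforce simp: S_def)
  define L where "L = {x \<in> unit_cube. f x = 1/2}"
  have "closed L"
    unfolding L_def Collect_conj_eq
    by (intro closed_Int closed_Collect_eq f continuous_intros)
      (simp add: compact_imp_closed compact_unit_cube)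
  moreover have "r ` D \<subseteq> L"
    using D_h r by (auto simp: L_def h_def)
  \<comment> \<open>\<open>D\<close> may be unbounded, so its image under \<open>r\<close> need not
    be closed. The closure stays at level 1/2 of \<open>f\<close>, hence off \<open>U\<close>,
    \<open>V\<close> and \<open>K\<close>.\<close>
  ultimately have CL: "closure (r ` D) \<subseteq> L"
    by (simp add: closure_minimal)
  show thesis
  proof
    show "compact (closure (r ` D))"
      using closed_Int_compact[OF closed_closure compact_unit_cube, of "r ` D"] CL
      by (simp add: L_def Int_absorb2 subset_iff)
    show "connected (closure (r ` D))"
      using D(1) r(1) by (intro connected_imp_connected_closure connected_continuous_image)
        (auto intro: in_components_connected)
    show "closure (r ` D) \<subseteq> unit_cube"
      using CL by (auto simp: L_def)
    show "closure (r ` D) \<inter> K = {}"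
      using CL UV(4) f by (force simp: L_def)
    fix T :: "(real ^ 'n) set"
    assume T: "connected T" "T \<subseteq> unit_cube" "T \<inter> face_minus k \<noteq> {}" "T \<inter> face_plus k \<noteq> {}"
    show "T \<inter> closure (r ` D) \<noteq> {}"
    proof
      assume *: "T \<inter> closure (r ` D) = {}"
      \<comment> \<open>\<open>r\<close> fixes \<open>T\<close> pointwise, so a common point of
        \<open>T\<close> and \<open>D\<close> also lies in the image of \<open>D\<close>.\<close>
      have "T \<inter> D = {}"
      proof -
        have "x \<in> r ` D" if "x \<in> T" "x \<in> D" for x
          using that T(2) r(3)[of x] by (metis imageI subsetD)
        then show ?thesis
          using * closure_subset by blast
      qed
      moreover have "face_minus k \<inter> D = {}" "face_plus k \<inter> D = {}"
        using hU hV UV(5,6) D_h face_minus_subset[of k] face_plus_subset[of k] by force+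
      \<comment> \<open>\<open>T\<close> bridges the two faces, which gives a connected set through
        \<open>a\<close> and \<open>b\<close> that avoids \<open>D\<close>.\<close>
      moreover have "connected (face_minus k \<union> T \<union> face_plus k)"
        using T connected_face_minus connected_face_plus
        by (intro connected_Un) auto
      ultimately have "connected_component (- D) a b"
        unfolding connected_component_def using ab
        by (intro exI[of _ "face_minus k \<union> T \<union> face_plus k"]) auto
      then show False
        using D(2) by simp
    qed
  qed
qed

text \<open>For \<open>j \<noteq> k\<close> each \<open>j\<close>-face is itself a connected set
  joining the \<open>k\<close>-faces, so \<open>C\<close> meets both \<open>j\<close>-faces.\<close>

lemma separating_set_connects_faces:
  fixes C :: "(real ^ 'n::finite) set"
  assumes "connected C" "j \<noteq> k"
    and "\<And>T. \<lbrakk>connected T; T \<subseteq> unit_cube; T \<inter> face_minus k \<noteq> {}; T \<inter> face_plus k \<noteq> {}\<rbrakk> \<Longrightarrow> T \<inter> C \<noteq> {}"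
  shows "connects_faces j C"
  unfolding connects_faces_def
  using assms(1) assms(3)[OF connected_face_minus face_minus_subset]
    assms(3)[OF connected_face_plus face_plus_subset] face_intersections_nonempty[OF assms(2)]
  by blast

lemma separating_set_not_connects_faces:
  fixes C :: "(real ^ 'n::finite) set"
  assumes "\<And>T. \<lbrakk>connected T; T \<subseteq> unit_cube; T \<inter> face_minus k \<noteq> {}; T \<inter> face_plus k \<noteq> {}\<rbrakk> \<Longrightarrow> T \<inter> C \<noteq> {}"
    and "A \<subseteq> unit_cube" "A \<inter> C = {}"
  shows "\<not> connects_faces k A"
  unfolding connects_faces_def using assms by blast

subsection \<open>Preimages of intervals\<close>

lemma cube_preimage_subset: "cube_preimage g P \<subseteq> unit_cube"
  by (auto simp: cube_preimage_def)

lemma cube_preimage_mono: "P \<subseteq> Q \<Longrightarrow> cube_preimage g P \<subseteq> cube_preimage g Q"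
  by (auto simp: cube_preimage_def)

lemma compact_cube_preimage:
  fixes g :: "real ^ 'n::finite \<Rightarrow> real"
  assumes "continuous_on unit_cube g" "closed P"
  shows "compact (cube_preimage g P)"
proof -
  have "cube_preimage g P = unit_cube \<inter> g -` P"
    by (auto simp: cube_preimage_def)
  moreover have "closed (unit_cube \<inter> g -` P)"
    using assms compact_imp_closed[OF compact_unit_cube] by (intro continuous_closed_preimage)
  ultimately show ?thesis
    using compact_Int_closed[OF compact_unit_cube] by (metis inf.left_idem)
qed

text \<open>If the band did not connect, some continuum missing it would meet every connecting set.
  Being connected, it would have all its \<open>g\<close>-values below \<open>p\<close> or all above
  \<open>q\<close>, and so miss one of the two half-line preimages. The case \<open>p = q\<close>
  describes \<open>Conn_at\<close>.\<close>

lemma connects_between_iff: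
  fixes g :: "real ^ 'n::finite \<Rightarrow> real"
  assumes g: "continuous_on unit_cube g" and "p \<le> q"
  shows "connects_faces k (cube_preimage g {p..q}) \<longleftrightarrow>
    connects_faces k (cube_preimage g {p..}) \<and> connects_faces k (cube_preimage g {..q})"
proof
  show "connects_faces k (cube_preimage g {p..}) \<and> connects_faces k (cube_preimage g {..q})"
    if "connects_faces k (cube_preimage g {p..q})"
    using that by (auto elim!: connects_faces_mono intro!: cube_preimage_mono)
next
  assume *: "connects_faces k (cube_preimage g {p..}) \<and> connects_faces k (cube_preimage g {..q})"
  show "connects_faces k (cube_preimage g {p..q})"
  proof (rule ccontr)
    assume "\<not> connects_faces k (cube_preimage g {p..q})"
    then obtain C where C: "connected C" "C \<subseteq> unit_cube" "C \<inter> cube_preimage g {p..q} = {}"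
      and sep: "\<And>T. \<lbrakk>connected T; T \<subseteq> unit_cube; T \<inter> face_minus k \<noteq> {}; T \<inter> face_plus k \<noteq> {}\<rbrakk>
        \<Longrightarrow> T \<inter> C \<noteq> {}"
      using separating_continuum[OF compact_cube_preimage[OF g closed_atLeastAtMost]
          cube_preimage_subset] by metis
    have hit: "\<exists>x\<in>C. g x \<in> P" if "connects_faces k (cube_preimage g P)" for P
      using separating_set_not_connects_faces[OF sep cube_preimage_subset] that
      by (fastforce simp: cube_preimage_def)
    have avoid: "g x < p \<or> q < g x" if "x \<in> C" for x
      using C that by (force simp: cube_preimage_def)
    obtain x y where "x \<in> C" "g x \<ge> p" "y \<in> C" "g y \<le> q"
      using * hit[of "{p..}"] hit[of "{..q}"] by auto
    \<comment> \<open>Since \<open>C\<close> avoids the band, \<open>g\<close> lies on both sides of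
      it on \<open>C\<close>, and connectedness forces the forbidden value \<open>p\<close>.\<close>
    moreover from this have "g x > q" "g y < p"
      using avoid by force+
    moreover have "connected (g ` C)"
      by (intro connected_continuous_image C continuous_on_subset[OF g])
    ultimately have "p \<in> g ` C"
      using connectedD_interval[of "g ` C" "g y" "g x" p] by force
    then show False
      using avoid \<open>p \<le> q\<close> by force
  qed
qed

section \<open>Thresholds of sublevel and superlevel sets\<close>

text \<open>Both claims come from one separating continuum \<open>C\<close>, on which
  \<open>g > p\<close>. By compactness a slightly higher sublevel set still misses \<open>C\<close>,
  which later makes the threshold attained; and \<open>C\<close> itself connects the faces in every
  other direction, which relates thresholds of different directions.\<close>

lemma not_connects_sublevel:
  fixes g :: "real ^ 'n::finite \<Rightarrow> real"
  assumes g: "continuous_on unit_cube g" and nc: "\<not> connects_faces k (cube_preimage g {..p})"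
  shows "\<exists>q>p. \<not> connects_faces k (cube_preimage g {..q})"
    and "j \<noteq> k \<Longrightarrow> connects_faces j (cube_preimage g {p..})"
proof -
  obtain C where C: "compact C" "connected C" "C \<subseteq> unit_cube" "C \<inter> cube_preimage g {..p} = {}"
    and sep: "\<And>T. \<lbrakk>connected T; T \<subseteq> unit_cube; T \<inter> face_minus k \<noteq> {}; T \<inter> face_plus k \<noteq> {}\<rbrakk>
      \<Longrightarrow> T \<inter> C \<noteq> {}"
    using separating_continuum[OF compact_cube_preimage[OF g closed_atMost]
        cube_preimage_subset nc] by metis
  have above: "g x > p" if "x \<in> C" for x
    using C that by (force simp: cube_preimage_def)
  \<comment> \<open>The whole cube connects the faces, so it has to meet \<open>C\<close>.\<close>
  have "C \<noteq> {}"
    using separating_set_not_connects_faces[OF sep, where A = unit_cube] connects_faces_unit_cube[of k]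
    by blast
  then obtain c where c: "c \<in> C" "\<And>x. x \<in> C \<Longrightarrow> g c \<le> g x"
    using continuous_attains_inf[OF C(1)] continuous_on_subset[OF g C(3)] by metis
  obtain q where q: "p < q" "q < g c"
    using above[OF c(1)] dense by blast
  have "cube_preimage g {..q} \<inter> C = {}"
    using c q by (force simp: cube_preimage_def)
  then show "\<exists>q>p. \<not> connects_faces k (cube_preimage g {..q})"
    using separating_set_not_connects_faces[OF sep cube_preimage_subset] q by blast
  show "connects_faces j (cube_preimage g {p..})" if "j \<noteq> k"
  proof (rule connects_faces_mono)
    show "connects_faces j C"
      by (rule separating_set_connects_faces[OF C(2) that sep])
    show "C \<subseteq> cube_preimage g {p..}"
      using C(3) less_imp_le[OF above] by (auto simp: cube_preimage_def)
  qed
qed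

text \<open>On a connected set with \<open>g < p\<close> the supremum of \<open>g\<close> may equal
  \<open>p\<close>. A path in the open set where \<open>g \<circ> r < p\<close> has a compact image,
  so the maximum along it is below \<open>p\<close>; \<open>r\<close> brings the path back into the
  cube.\<close>

lemma connects_strict_sublevelD:
  fixes g :: "real ^ 'n::finite \<Rightarrow> real"
  assumes g: "continuous_on unit_cube g" and "connects_faces k (cube_preimage g {..<p})"
  shows "\<exists>q<p. connects_faces k (cube_preimage g {..q})"
proof -
  obtain r :: "real ^ 'n \<Rightarrow> real ^ 'n" where
    r: "\<And>S. continuous_on S r" "\<And>x. r x \<in> unit_cube" "\<And>x. x \<in> unit_cube \<Longrightarrow> r x = x"
    using unit_cube_retraction by blast
  obtain S x y where S: "connected S" "S \<subseteq> cube_preimage g {..<p}" "x \<in> S" "y \<in> S"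
    and xy: "x \<in> face_minus k" "y \<in> face_plus k"
    using assms(2) unfolding connects_faces_def by blast
  have gr: "continuous_on UNIV (g \<circ> r)"
    using r g by (intro continuous_on_compose) (auto intro: continuous_on_subset)
  define W where "W = {z. (g \<circ> r) z < p}"
  have "open W"
    unfolding W_def by (intro open_Collect_less gr continuous_intros)
  moreover have "S \<subseteq> W"
    using S r by (force simp: W_def cube_preimage_def)
  ultimately have "path_component W x y"
    using S open_path_connected_component[of W x] by (auto simp: connected_component_def)
  then obtain \<gamma> where \<gamma>: "path \<gamma>" "path_image \<gamma> \<subseteq> W" "pathstart \<gamma> = x" "pathfinish \<gamma> = y"
    by (auto simp: path_component_def)
  let ?P = "path_image \<gamma>"
  have "x \<in> ?P" "y \<in> ?P"
    using \<gamma> pathstart_in_path_image pathfinish_in_path_image by blast+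
  obtain c where c: "c \<in> ?P" "\<And>z. z \<in> ?P \<Longrightarrow> (g \<circ> r) z \<le> (g \<circ> r) c"
    using continuous_attains_sup[OF compact_path_image[OF \<gamma>(1)] path_image_nonempty
        continuous_on_subset[OF gr subset_UNIV]] by metis
  have "r x = x" "r y = y"
    using xy r face_minus_subset face_plus_subset by blast+
  then have "r ` ?P \<inter> face_minus k \<noteq> {}" "r ` ?P \<inter> face_plus k \<noteq> {}"
    using xy \<open>x \<in> ?P\<close> \<open>y \<in> ?P\<close> by (metis IntI empty_iff imageI)+
  moreover have "connected (r ` ?P)"
    using \<gamma> r by (intro connected_continuous_image connected_path_image)
  moreover have "r ` ?P \<subseteq> cube_preimage g {..(g \<circ> r) c}"
    using c r by (auto simp: cube_preimage_def)
  ultimately have "connects_faces k (cube_preimage g {..(g \<circ> r) c})"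
    unfolding connects_faces_def by blast
  then show ?thesis
    using c \<gamma> by (auto simp: W_def)
qed

text \<open>The threshold is the infimum of the connecting levels. It is attained because failure to
  connect persists at slightly higher levels. A connecting strict sublevel set contains a connecting
  closed one of lower level, which gives the strict version.\<close>

lemma sublevel_threshold:
  fixes g :: "real ^ 'n::finite \<Rightarrow> real"
  assumes g: "continuous_on unit_cube g"
  obtains a where "\<And>p. connects_faces k (cube_preimage g {..p}) \<longleftrightarrow> a \<le> p"
    and "\<And>p. connects_faces k (cube_preimage g {..<p}) \<longleftrightarrow> a < p"
proof -
  let ?L = "\<lambda>p. connects_faces k (cube_preimage g {..p})"
  obtain m M where m: "\<And>x. x \<in> unit_cube \<Longrightarrow> g m \<le> g x" and M: "\<And>x. x \<in> unit_cube \<Longrightarrow> g x \<le> g M"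
    using continuous_attains_inf[OF compact_unit_cube unit_cube_nonempty g]
      continuous_attains_sup[OF compact_unit_cube unit_cube_nonempty g] by metis
  have up: "?L q" if "?L p" "p \<le> q" for p q
    using that by (auto elim!: connects_faces_mono intro!: cube_preimage_mono)
  have "cube_preimage g {..g M} = unit_cube"
    using M by (auto simp: cube_preimage_def)
  then have top: "?L (g M)"
    using connects_faces_unit_cube by metis
  have low: "g m \<le> p" if "?L p" for p
    using connects_faces_nonempty[OF that] m by (force simp: cube_preimage_def)
  have bdd: "bdd_below {p. ?L p}"
    using low by (auto simp: bdd_below_def)
  have a: "?L p \<longleftrightarrow> Inf {p. ?L p} \<le> p" for p
  proof
    show "Inf {p. ?L p} \<le> p" if "?L p"
      using that bdd by (simp add: cInf_lower)
    show "?L p" if le: "Inf {p. ?L p} \<le> p"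
    proof (rule ccontr)
      assume "\<not> ?L p"
      then obtain q where q: "q > p" "\<not> ?L q"
        using not_connects_sublevel(1)[OF g] by blast
      \<comment> \<open>Connecting levels are upward closed, so the failing level \<open>q\<close>
        bounds them all from below.\<close>
      have "q \<le> Inf {p. ?L p}"
        using top q(2) up by (intro cInf_greatest) (auto intro: leI less_imp_le)
      then show False
        using q le by simp
    qed
  qed
  show thesis
  proof
    show "?L p \<longleftrightarrow> Inf {p. ?L p} \<le> p" for p
      by (rule a)
    show "connects_faces k (cube_preimage g {..<p}) \<longleftrightarrow> Inf {p. ?L p} < p" for p
    proof
      show "Inf {p. ?L p} < p" if "connects_faces k (cube_preimage g {..<p})"
        using connects_strict_sublevelD[OF g that] a le_less_trans by blast
      show "connects_faces k (cube_preimage g {..<p})" if "Inf {p. ?L p} < p"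
        using iffD2[OF a order_refl]
        by (rule connects_faces_mono) (intro cube_preimage_mono, use that in auto)
    qed
  qed
qed

text \<open>The sublevel thresholds of \<open>- g\<close>, with the sign reversed.\<close>

lemma superlevel_threshold:
  fixes g :: "real ^ 'n::finite \<Rightarrow> real"
  assumes g: "continuous_on unit_cube g"
  obtains b where "\<And>p. connects_faces k (cube_preimage g {p..}) \<longleftrightarrow> p \<le> b"
    and "\<And>p. connects_faces k (cube_preimage g {p<..}) \<longleftrightarrow> p < b"
proof -
  have eq: "cube_preimage (\<lambda>x. - g x) {..- p} = cube_preimage g {p..}"
    "cube_preimage (\<lambda>x. - g x) {..<- p} = cube_preimage g {p<..}" for p
    by (auto simp: cube_preimage_def)
  obtain a where "\<And>p. connects_faces k (cube_preimage (\<lambda>x. - g x) {..p}) \<longleftrightarrow> a \<le> p"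
    and "\<And>p. connects_faces k (cube_preimage (\<lambda>x. - g x) {..<p}) \<longleftrightarrow> a < p"
    using sublevel_threshold[OF continuous_on_minus[OF g]] by metis
  then show thesis
    using that[of "- a"] by (metis eq le_minus_iff less_minus_iff)
qed

text \<open>On a connected set avoiding the level \<open>p\<close>, \<open>g\<close> stays strictly
  on one side of \<open>p\<close>. Hence the strict thresholds determine
  \<open>Sep_at\<close>.\<close>

lemma connects_complement_of_level_iff:
  fixes g :: "real ^ 'n::finite \<Rightarrow> real"
  assumes g: "continuous_on unit_cube g"
  shows "connects_faces k (unit_cube - cube_preimage g {p}) \<longleftrightarrow>
    connects_faces k (cube_preimage g {..<p}) \<or> connects_faces k (cube_preimage g {p<..})"
proof
  show "connects_faces k (unit_cube - cube_preimage g {p})"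
    if "connects_faces k (cube_preimage g {..<p}) \<or> connects_faces k (cube_preimage g {p<..})"
    using that by (auto elim!: connects_faces_mono simp: cube_preimage_def)
next
  assume "connects_faces k (unit_cube - cube_preimage g {p})"
  then obtain S where S: "S \<subseteq> unit_cube - cube_preimage g {p}" "connected S"
    "S \<inter> face_minus k \<noteq> {}" "S \<inter> face_plus k \<noteq> {}"
    by (auto simp: connects_faces_def)
  have "connected (g ` S)"
    by (intro connected_continuous_image S continuous_on_subset[OF g]) (use S in auto)
  moreover have "p \<notin> g ` S"
    using S by (auto simp: cube_preimage_def)
  ultimately have "g ` S \<subseteq> {..<p} \<or> g ` S \<subseteq> {p<..}"
    using connectedD_interval[of "g ` S" _ _ p]
    by (meson greaterThan_iff lessThan_iff linorder_not_le subsetI)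
  then have "S \<subseteq> cube_preimage g {..<p} \<or> S \<subseteq> cube_preimage g {p<..}"
    using S(1) by (auto simp: cube_preimage_def)
  then show "connects_faces k (cube_preimage g {..<p}) \<or> connects_faces k (cube_preimage g {p<..})"
    using S unfolding connects_faces_def by blast
qed

text \<open>Either interval below is empty when its endpoints are in the wrong order.\<close>

lemma Conn_Sep_thresholds:
  fixes g :: "real ^ 'n::finite \<Rightarrow> real"
  assumes g: "continuous_on unit_cube g"
  obtains a b where "\<And>k p. connects_faces k (cube_preimage g {..p}) \<longleftrightarrow> a k \<le> p"
    and "\<And>k p. connects_faces k (cube_preimage g {p..}) \<longleftrightarrow> p \<le> b k"
    and "\<And>k. Conn_at k g = {a k..b k}" and "\<And>k. Sep_at k g = {b k..a k}"
    and "\<And>j k. j \<noteq> k \<Longrightarrow> a j \<le> b k"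
proof -
  have "\<forall>k. \<exists>a. (\<forall>p. connects_faces k (cube_preimage g {..p}) \<longleftrightarrow> a \<le> p) \<and>
      (\<forall>p. connects_faces k (cube_preimage g {..<p}) \<longleftrightarrow> a < p)"
    using sublevel_threshold[OF g] by metis
  then obtain a where a: "\<And>k p. connects_faces k (cube_preimage g {..p}) \<longleftrightarrow> a k \<le> p"
      "\<And>k p. connects_faces k (cube_preimage g {..<p}) \<longleftrightarrow> a k < p"
    by metis
  have "\<forall>k. \<exists>b. (\<forall>p. connects_faces k (cube_preimage g {p..}) \<longleftrightarrow> p \<le> b) \<and>
      (\<forall>p. connects_faces k (cube_preimage g {p<..}) \<longleftrightarrow> p < b)"
    using superlevel_threshold[OF g] by metis
  then obtain b where b: "\<And>k p. connects_faces k (cube_preimage g {p..}) \<longleftrightarrow> p \<le> b k"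
      "\<And>k p. connects_faces k (cube_preimage g {p<..}) \<longleftrightarrow> p < b k"
    by metis
  show thesis
  proof
    show "Conn_at k g = {a k..b k}" for k
      using connects_between_iff[OF g order_refl, of k] a b by (auto simp: Conn_at_def)
    show "Sep_at k g = {b k..a k}" for k
      using connects_complement_of_level_iff[OF g, of k] a b
      by (auto simp: Sep_at_def separates_faces_def)
    show "a j \<le> b k" if "j \<noteq> k" for j k
    \<comment> \<open>Below \<open>a j\<close> the sublevel set fails to connect the
      \<open>j\<close>-faces, so the superlevel set connects the \<open>k\<close>-faces; then
      \<open>p\<close> increases to \<open>a j\<close>.\<close>
    proof (rule dense_le)
      show "p \<le> b k" if "p < a j" for p
        using not_connects_sublevel(2)[OF g, of j p k] a b that \<open>j \<noteq> k\<close> by force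
    qed
  qed (use a b in auto)
qed

subsection \<open>Intervals with dominated endpoints\<close>

lemma INT_atLeastAtMost_eq:
  fixes a b :: "'a \<Rightarrow> 'b::linorder"
  assumes "finite I" "I \<noteq> {}"
  shows "(\<Inter>k\<in>I. {a k..b k}) = {Max (a ` I)..Min (b ` I)}"
proof -
  have "x \<in> (\<Inter>k\<in>I. {a k..b k}) \<longleftrightarrow> Max (a ` I) \<le> x \<and> x \<le> Min (b ` I)" for x
    using Max_le_iff[of "a ` I" x] Min_ge_iff[of "b ` I" x] assms by auto
  then show ?thesis
    by (intro set_eqI) (simp only: atLeastAtMost_iff)
qed

text \<open>The hypothesis, taken in both orders, makes any two nonempty intervals overlap. The
  endpoints are arbitrary functions because the lemma serves \<open>Conn g\<close> and, with
  \<open>a\<close> and \<open>b\<close> exchanged, \<open>Sep g\<close>.\<close>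

lemma compact_connected_UN_intervals:
  fixes a b :: "'a::finite \<Rightarrow> real"
  assumes "\<And>i j. a i \<le> b i \<Longrightarrow> a j \<le> b j \<Longrightarrow> a i \<le> b j"
  shows "compact (\<Union>i. {a i..b i})" "connected (\<Union>i. {a i..b i})"
proof -
  show "compact (\<Union>i. {a i..b i})"
    by (intro compact_UN) auto
  show "connected (\<Union>i. {a i..b i})"
  proof (rule connectedI_interval)
    fix x y z assume "x \<in> (\<Union>i. {a i..b i})" "y \<in> (\<Union>i. {a i..b i})" "x \<le> z" "z \<le> y"
    then obtain i j where "a i \<le> x" "x \<le> b i" "a j \<le> y" "y \<le> b j"
      by auto
    \<comment> \<open>Either \<open>z \<le> b i\<close>, or
      \<open>a j \<le> b i < z \<le> b j\<close>.\<close>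
    with \<open>x \<le> z\<close> \<open>z \<le> y\<close> assms[of j i] have "z \<in> {a i..b i} \<or> z \<in> {a j..b j}"
      by auto
    then show "z \<in> (\<Union>i. {a i..b i})"
      by blast
  qed
qed

theorem corollary5p15:
  fixes g :: "real ^ 'n::finite \<Rightarrow> real" and i j :: 'n
  assumes "CARD('n) \<ge> 2"
    and "continuous_on unit_cube g"
  shows "(Conn_at i g = {} \<longrightarrow> compact_interval (\<Inter>k\<in>UNIV - {i}. Conn_at k g)) \<and>
    (Sep g \<noteq> {} \<longleftrightarrow> (\<exists>k. finite (Conn_at k g) \<and> card (Conn_at k g) \<le> 1)) \<and>
    (Conn_at i g \<noteq> {} \<and> Conn_at j g \<noteq> {} \<longrightarrow> Conn_at i g \<inter> Conn_at j g \<noteq> {}) \<and>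
    ((\<forall>k. Conn_at k g \<noteq> {}) \<longrightarrow> (\<Inter>k. Conn_at k g) \<noteq> {}) \<and>
    ((\<forall>k. k \<noteq> i \<longrightarrow> Conn_at k g \<noteq> {}) \<longrightarrow>
       connects_faces i (cube_preimage g (\<Inter>k\<in>UNIV - {i}. Conn_at k g))) \<and>
    (compact (Conn g) \<and> connected (Conn g) \<and> compact (Sep g) \<and> connected (Sep g))"
proof -
  obtain a b where a: "\<And>k p. connects_faces k (cube_preimage g {..p}) \<longleftrightarrow> a k \<le> p"
    and b: "\<And>k p. connects_faces k (cube_preimage g {p..}) \<longleftrightarrow> p \<le> b k"
    and conn: "\<And>k. Conn_at k g = {a k..b k}" and sep: "\<And>k. Sep_at k g = {b k..a k}"
    and ab: "\<And>j k. j \<noteq> k \<Longrightarrow> a j \<le> b k"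
    using Conn_Sep_thresholds[OF assms(2)] by metis
  \<comment> \<open>With at least two coordinates, \<open>Max\<close> and \<open>Min\<close> below
    range over nonempty sets.\<close>
  have "UNIV - {i} \<noteq> {}"
  proof
    assume "UNIV - {i} = {}"
    then have "CARD('n) \<le> card {i}"
      by (intro card_mono) auto
    then show False
      using assms(1) by simp
  qed
  then have Int_i: "(\<Inter>k\<in>UNIV - {i}. Conn_at k g) = {Max (a ` (UNIV - {i}))..Min (b ` (UNIV - {i}))}"
    unfolding conn by (intro INT_atLeastAtMost_eq) auto
  have Max_a: "Max (a ` (UNIV - {i})) \<le> b i" and Min_b: "a i \<le> Min (b ` (UNIV - {i}))"
    using \<open>UNIV - {i} \<noteq> {}\<close> ab by auto
  \<comment> \<open>Emptiness of \<open>Conn_at i g\<close> means \<open>b i < a i\<close>; placed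
    between \<open>Max_a\<close> and \<open>Min_b\<close>, it makes the interval
    nondegenerate.\<close>
  have "compact_interval (\<Inter>k\<in>UNIV - {i}. Conn_at k g)" if "Conn_at i g = {}"
    unfolding compact_interval_def Int_i using that Max_a Min_b conn by force
  moreover have "Sep g \<noteq> {} \<longleftrightarrow> (\<exists>k. finite (Conn_at k g) \<and> card (Conn_at k g) \<le> 1)"
  proof -
    \<comment> \<open>The left side says that \<open>Sep_at k g\<close> is nonempty. Finiteness is
      stated explicitly because \<open>card\<close> of an infinite set is 0.\<close>
    have "b k \<le> a k \<longleftrightarrow> finite (Conn_at k g) \<and> card (Conn_at k g) \<le> 1" for k
    proof
      assume "b k \<le> a k"
      then have "Conn_at k g \<subseteq> {a k}"
        by (auto simp: conn)
      then show "finite (Conn_at k g) \<and> card (Conn_at k g) \<le> 1"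
        using card_mono[of "{a k}"] finite_subset by fastforce
    next
      assume "finite (Conn_at k g) \<and> card (Conn_at k g) \<le> 1"
      then show "b k \<le> a k"
        using infinite_Icc[of "a k" "b k"] by (metis conn not_le)
    qed
    then show ?thesis
      by (auto simp: Sep_def sep)
  qed
  moreover have pair: "a k \<le> b l" if "a k \<le> b k" "a l \<le> b l" for k l
    using that ab[of k l] by (cases "k = l") auto
  then have "Conn_at i g \<inter> Conn_at j g \<noteq> {}" if "Conn_at i g \<noteq> {}" "Conn_at j g \<noteq> {}"
    using that pair[of i j] pair[of j i] by (auto simp: conn)
  moreover have "(\<Inter>k. Conn_at k g) \<noteq> {}" if "\<forall>k. Conn_at k g \<noteq> {}"
  proof -
    \<comment> \<open>Helly's theorem on the line: pairwise overlap puts every left endpoint below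
      every right one.\<close>
    have "Max (range a) \<le> Min (range b)"
      using that pair by (auto simp: conn)
    then show ?thesis
      unfolding conn by (simp add: INT_atLeastAtMost_eq)
  qed
  moreover have "connects_faces i (cube_preimage g (\<Inter>k\<in>UNIV - {i}. Conn_at k g))"
    if "\<forall>k. k \<noteq> i \<longrightarrow> Conn_at k g \<noteq> {}"
  proof -
    have "Max (a ` (UNIV - {i})) \<le> Min (b ` (UNIV - {i}))"
      using \<open>UNIV - {i} \<noteq> {}\<close> that pair by (auto simp: conn)
    \<comment> \<open>In direction \<open>i\<close>, \<open>Max_a\<close> and \<open>Min_b\<close>
      are exactly the two half-line conditions of \<open>connects_between_iff\<close>.\<close>
    then show ?thesis
      unfolding Int_i using connects_between_iff[OF assms(2)] Max_a Min_b a b by blast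
  qed
  moreover have "compact (Conn g)" "connected (Conn g)"
    unfolding Conn_def conn using compact_connected_UN_intervals[of a b] pair by blast+
  \<comment> \<open>For \<open>k \<noteq> l\<close> the chain
    \<open>b k \<le> a k \<le> b l \<le> a l \<le> b k\<close> collapses: both intervals are the
    same single point.\<close>
  moreover have "b k \<le> a l" if "b k \<le> a k" "b l \<le> a l" for k l
    using that ab[of k l] ab[of l k] by (cases "k = l") auto
  then have "compact (Sep g)" "connected (Sep g)"
    unfolding Sep_def sep using compact_connected_UN_intervals[of b a] by blast+
  ultimately show ?thesis
    by blast
qed

end
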